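(* Let $D$ be a weighted oriented graph and let $D'$ be an induced subgraph of $D$ whose underlying graph is an odd cycle $C_{2n+1}=(x_1,\ldots,x_{2n+1})$ (so $n\ge 1$). Suppose $V(C_{2n+1})\nsubseteq N_D^+(V^+(D))$ and that the following condition holds: the set $V(C_{2n+1})\setminus N_D^+(V^+(D))$ contains a vertex which is not a source in $D'$, or otherwise it contains a vertex which is a source in $D'$ and has trivial weight (weight $1$) in $D$. Then $I(D)^{(n+1)}\neq I(D)^{n+1}$.
   Context: Let $k$ be a field. A weighted oriented graph $D=(V(D),E(D),w)$ has a finite vertex set $V(D)$, a set $E(D)$ of ordered pairs of distinct vertices ($(x,y)\in E(D)$ is a directed edge from $x$ to $y$), each edge $\{x,y\}$ of the underlying simple graph $G$ carrying exactly one orientation, and a weight function $w:V(D)\to\mathbb N=\{1,2,\dots\}$. A vertex $x$ is a source if it has only outgoing edges; convention: sources have weight $1$. The edge ideal of $D$ is $I(D)=(x\,y^{w(y)} : (x,y)\in E(D))$ in the polynomial ring $R$ over $k$ whose variables are the vertices of $D$. For $s\ge1$ the $s$-th symbolic power of an ideal $I$ is $I^{(s)}=\bigcap_{P\in\operatorname{Ass}(I)}(I^sR_P\cap R)$, where $\operatorname{Ass}(I)$ is the set of associated primes of $R/I$. $V^+(D)$ is the set of vertices of $D$ with non-trivial weight, i.e. $w(x)\ne1$. For $W\subseteq V(D)$, $N_D^+(W)=\{y : (x,y)\in E(D)\text{ for some }x\in W\}$. An induced subgraph on $T\subseteq V(D)$ has all edges of $D$ between vertices of $T$ with the same orientation;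 the weight of a vertex is as in $D$, except that a vertex that is a source in the induced subgraph gets weight $1$ there. *)

theory Defs
  imports "HOL-Library.Poly_Mapping" "HOL-Algebra.QuotRing" "HOL-Algebra.Ideal_Product"
begin

section \<open>The polynomial ring on a set of variables\<close>

text \<open>A monomial is a finitely supported exponent function; a polynomial is a finitely supported
  coefficient function on monomials. The ring \<open>k[V]\<close> consists of the polynomials in which only
  variables from \<open>V\<close> occur.\<close>

definition poly_ring :: "'v set \<Rightarrow> (('v \<Rightarrow>\<^sub>0 nat) \<Rightarrow>\<^sub>0 'k::field) ring" where
  "poly_ring V =
     \<lparr>carrier = {p. \<forall>m \<in> Poly_Mapping.keys p. Poly_Mapping.keys m \<subseteq> V},
      monoid.mult = (*), one = 1, zero = 0, add = (+)\<rparr>"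

definition pvar :: "'v \<Rightarrow> ('v \<Rightarrow>\<^sub>0 nat) \<Rightarrow>\<^sub>0 'k::field" where
  "pvar v = Poly_Mapping.single (Poly_Mapping.single v 1) 1"

lemma cring_poly_ring: "cring (poly_ring V :: (('v \<Rightarrow>\<^sub>0 nat) \<Rightarrow>\<^sub>0 'k::field) ring)" (is "cring ?R")
proof -
  have carr: "p \<in> carrier ?R \<longleftrightarrow> (\<forall>m \<in> Poly_Mapping.keys p. Poly_Mapping.keys m \<subseteq> V)" for p
    by (simp add: poly_ring_def)
  have ops: "p \<otimes>\<^bsub>?R\<^esub> q = p * q" "p \<oplus>\<^bsub>?R\<^esub> q = p + q" "\<one>\<^bsub>?R\<^esub> = 1" "\<zero>\<^bsub>?R\<^esub> = 0" for p q
    by (simp_all add: poly_ring_def)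
  have add: "p + q \<in> carrier ?R" if "p \<in> carrier ?R" "q \<in> carrier ?R" for p q
    using that Poly_Mapping.keys_add[of p q] unfolding carr by blast
  have uminus: "- p \<in> carrier ?R" if "p \<in> carrier ?R" for p
    using that by (simp add: carr)
  have mult: "p * q \<in> carrier ?R" if p: "p \<in> carrier ?R" and q: "q \<in> carrier ?R" for p q
    unfolding carr
  proof
    fix m assume "m \<in> Poly_Mapping.keys (p * q)"
    then have "m \<in> {a + b | a b. a \<in> Poly_Mapping.keys p \<and> b \<in> Poly_Mapping.keys q}"
      using keys_mult[of p q] by (rule rev_subsetD)
    then obtain a b where m: "m = a + b" and ab: "a \<in> Poly_Mapping.keys p" "b \<in> Poly_Mapping.keys q"
      by blast
    have "Poly_Mapping.keys a \<subseteq> V" "Poly_Mapping.keys b \<subseteq> V"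
      using p q ab by (simp_all add: carr)
    then show "Poly_Mapping.keys m \<subseteq> V"
      unfolding m using Poly_Mapping.keys_add[of a b] by (meson Un_least order_trans)
  qed
  have zero: "0 \<in> carrier ?R" and one: "1 \<in> carrier ?R"
    by (simp_all add: carr)
  have "abelian_group ?R"
  proof (rule abelian_groupI, unfold ops)
    fix x assume "x \<in> carrier ?R"
    then show "\<exists>y \<in> carrier ?R. y + x = 0"
      using uminus by (intro bexI[of _ "- x"]) simp_all
  qed (simp_all add: add zero add.assoc add.commute)
  moreover have "comm_monoid ?R"
    by (rule comm_monoidI, unfold ops) (simp_all add: mult one mult.assoc mult.commute)
  ultimately show ?thesis
    by (rule cringI) (simp add: ops distrib_right)
qed


section \<open>Localization, associated primes and symbolic powers\<close>

definition frac_rel :: "('a, 'b) ring_scheme \<Rightarrow> 'a set \<Rightarrow> (('a \<times> 'a) \<times> ('a \<times> 'a)) set" where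
  "frac_rel R S = {((a, s), (b, t)). a \<in> carrier R \<and> b \<in> carrier R \<and> s \<in> S \<and> t \<in> S \<and>
     (\<exists>u \<in> S. u \<otimes>\<^bsub>R\<^esub> (a \<otimes>\<^bsub>R\<^esub> t) = u \<otimes>\<^bsub>R\<^esub> (b \<otimes>\<^bsub>R\<^esub> s))}"

definition loc_frac :: "('a, 'b) ring_scheme \<Rightarrow> 'a set \<Rightarrow> 'a \<Rightarrow> 'a \<Rightarrow> ('a \<times> 'a) set" where
  "loc_frac R S a s = frac_rel R S `` {(a, s)}"

definition localization :: "('a, 'b) ring_scheme \<Rightarrow> 'a set \<Rightarrow> ('a \<times> 'a) set ring" where
  "localization R S =
     \<lparr>carrier = {loc_frac R S a s | a s. a \<in> carrier R \<and> s \<in> S},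
      monoid.mult = (\<lambda>X Y. \<Union>(a, s) \<in> X. \<Union>(b, t) \<in> Y. loc_frac R S (a \<otimes>\<^bsub>R\<^esub> b) (s \<otimes>\<^bsub>R\<^esub> t)),
      one = loc_frac R S \<one>\<^bsub>R\<^esub> \<one>\<^bsub>R\<^esub>,
      zero = loc_frac R S \<zero>\<^bsub>R\<^esub> \<one>\<^bsub>R\<^esub>,
      add = (\<lambda>X Y. \<Union>(a, s) \<in> X. \<Union>(b, t) \<in> Y.
        loc_frac R S (a \<otimes>\<^bsub>R\<^esub> t \<oplus>\<^bsub>R\<^esub> b \<otimes>\<^bsub>R\<^esub> s) (s \<otimes>\<^bsub>R\<^esub> t))\<rparr>"

abbreviation localization_at :: "('a, 'b) ring_scheme \<Rightarrow> 'a set \<Rightarrow> ('a \<times> 'a) set ring" where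
  "localization_at R P \<equiv> localization R (carrier R - P)"

definition loc_map :: "('a, 'b) ring_scheme \<Rightarrow> 'a set \<Rightarrow> 'a \<Rightarrow> ('a \<times> 'a) set" where
  "loc_map R P a = loc_frac R (carrier R - P) a \<one>\<^bsub>R\<^esub>"

text \<open>The ideal \<open>J R\<^sub>P \<inter> R\<close>: extend \<open>J\<close> to \<open>R\<^sub>P\<close> and take the preimage under \<open>R \<rightarrow> R\<^sub>P\<close>.\<close>

definition loc_contraction :: "('a, 'b) ring_scheme \<Rightarrow> 'a set \<Rightarrow> 'a set \<Rightarrow> 'a set" where
  "loc_contraction R P J =
     {f \<in> carrier R. loc_map R P f \<in> genideal (localization_at R P) (loc_map R P ` J)}"

text \<open>The prime ideals of \<open>R\<close> that are the annihilator of an element of \<open>R/I\<close>.\<close>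

definition Ass :: "('a, 'b) ring_scheme \<Rightarrow> 'a set \<Rightarrow> 'a set set" where
  "Ass R I = {P. primeideal P R \<and>
     (\<exists>m \<in> carrier (R Quot I).
        P = {r \<in> carrier R. (I +>\<^bsub>R\<^esub> r) \<otimes>\<^bsub>R Quot I\<^esub> m = \<zero>\<^bsub>R Quot I\<^esub>})}"

definition ideal_power :: "('a, 'b) ring_scheme \<Rightarrow> 'a set \<Rightarrow> nat \<Rightarrow> 'a set" where
  "ideal_power R I s = I [^]\<^bsub>ideals_set R\<^esub> s"

definition symbolic_power :: "('a, 'b) ring_scheme \<Rightarrow> 'a set \<Rightarrow> nat \<Rightarrow> 'a set" where
  "symbolic_power R I s = carrier R \<inter> (\<Inter>P \<in> Ass R I. loc_contraction R P (ideal_power R I s))"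

text \<open>The localization is a commutative ring; in particular the ideal generated in it is not
  degenerate.\<close>

locale mult_subset = cring R for R (structure) +
  fixes S
  assumes S_sub: "S \<subseteq> carrier R"
    and S_one: "\<one> \<in> S"
    and S_mult: "\<lbrakk>s \<in> S; t \<in> S\<rbrakk> \<Longrightarrow> s \<otimes> t \<in> S"
begin

lemma S_carr: "s \<in> S \<Longrightarrow> s \<in> carrier R"
  using S_sub by blast

lemma equiv_frac_rel: "equiv (carrier R \<times> S) (frac_rel R S)"
proof (rule equivI)
  show "frac_rel R S \<subseteq> (carrier R \<times> S) \<times> (carrier R \<times> S)"
    by (auto simp: frac_rel_def)
  show "refl_on (carrier R \<times> S) (frac_rel R S)"
    using S_one by (auto simp: frac_rel_def refl_on_def)
  show "sym (frac_rel R S)"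
    by (rule symI) (auto simp: frac_rel_def, metis)
  show "trans (frac_rel R S)"
  proof (rule transI)
    fix x y z assume xy: "(x, y) \<in> frac_rel R S" and yz: "(y, z) \<in> frac_rel R S"
    obtain a s b t c r where [simp]: "x = (a, s)" "y = (b, t)" "z = (c, r)"
      by (metis prod.exhaust)
    from xy obtain u where u: "u \<in> S" "u \<otimes> (a \<otimes> t) = u \<otimes> (b \<otimes> s)"
      and abst: "a \<in> carrier R" "b \<in> carrier R" "s \<in> S" "t \<in> S"
      by (auto simp: frac_rel_def)
    from yz obtain v where v: "v \<in> S" "v \<otimes> (b \<otimes> r) = v \<otimes> (c \<otimes> t)"
      and cr: "c \<in> carrier R" "r \<in> S"
      by (auto simp: frac_rel_def)
    note carr = abst cr u(1) v(1) S_carr[OF abst(3)] S_carr[OF abst(4)] S_carr[OF cr(2)]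
      S_carr[OF u(1)] S_carr[OF v(1)]
    have "(u \<otimes> v \<otimes> t) \<otimes> (a \<otimes> r) = (u \<otimes> (a \<otimes> t)) \<otimes> (v \<otimes> r)"
      using carr by (simp add: m_ac)
    also have "\<dots> = (v \<otimes> (b \<otimes> r)) \<otimes> (u \<otimes> s)"
      unfolding u(2) using carr by (simp add: m_ac)
    also have "\<dots> = (u \<otimes> v \<otimes> t) \<otimes> (c \<otimes> s)"
      unfolding v(2) using carr by (simp add: m_ac)
    finally show "(x, z) \<in> frac_rel R S"
      using carr S_mult by (auto simp: frac_rel_def intro!: bexI[of _ "u \<otimes> v \<otimes> t"])
  qed
qed

lemma frac_eqI:
  assumes "a \<in> carrier R" "b \<in> carrier R" "s \<in> S" "t \<in> S" "u \<in> S"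
    and "u \<otimes> (a \<otimes> t) = u \<otimes> (b \<otimes> s)"
  shows "loc_frac R S a s = loc_frac R S b t"
  unfolding loc_frac_def
  by (rule equiv_class_eq[OF equiv_frac_rel]) (use assms in \<open>auto simp: frac_rel_def\<close>)

lemma frac_eqI':
  assumes "a \<in> carrier R" "b \<in> carrier R" "s \<in> S" "t \<in> S" "a \<otimes> t = b \<otimes> s"
  shows "loc_frac R S a s = loc_frac R S b t"
  using assms S_one by (intro frac_eqI[of a b s t \<one>]) auto

lemma loc_mult:
  assumes "a \<in> carrier R" "b \<in> carrier R" "s \<in> S" "t \<in> S"
  shows "loc_frac R S a s \<otimes>\<^bsub>localization R S\<^esub> loc_frac R S b t = loc_frac R S (a \<otimes> b) (s \<otimes> t)"
proof -
  have "congruent2 (frac_rel R S) (frac_rel R S) (\<lambda>(a, s) (b, t). loc_frac R S (a \<otimes> b) (s \<otimes> t))"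
  proof (rule congruent2I')
    fix y1 z1 y2 z2
    assume 1: "(y1, z1) \<in> frac_rel R S" and 2: "(y2, z2) \<in> frac_rel R S"
    obtain a s a' s' b t b' t' where
      [simp]: "y1 = (a, s)" "z1 = (a', s')" "y2 = (b, t)" "z2 = (b', t')"
      by (metis prod.exhaust)
    from 1 obtain u where u: "u \<in> S" "u \<otimes> (a \<otimes> s') = u \<otimes> (a' \<otimes> s)"
      and c1: "a \<in> carrier R" "a' \<in> carrier R" "s \<in> S" "s' \<in> S"
      by (auto simp: frac_rel_def)
    from 2 obtain v where v: "v \<in> S" "v \<otimes> (b \<otimes> t') = v \<otimes> (b' \<otimes> t)"
      and c2: "b \<in> carrier R" "b' \<in> carrier R" "t \<in> S" "t' \<in> S"
      by (auto simp: frac_rel_def)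
    note carr = c1 c2 u(1) v(1) c1(3,4)[THEN S_carr] c2(3,4)[THEN S_carr] S_carr[OF u(1)] S_carr[OF v(1)]
    have "(u \<otimes> v) \<otimes> ((a \<otimes> b) \<otimes> (s' \<otimes> t')) = (u \<otimes> (a \<otimes> s')) \<otimes> (v \<otimes> (b \<otimes> t'))"
      using carr by (simp add: m_ac)
    also have "\<dots> = (u \<otimes> v) \<otimes> ((a' \<otimes> b') \<otimes> (s \<otimes> t))"
      unfolding u(2) v(2) using carr by (simp add: m_ac)
    finally have "loc_frac R S (a \<otimes> b) (s \<otimes> t) = loc_frac R S (a' \<otimes> b') (s' \<otimes> t')"
      by (intro frac_eqI[of _ _ _ _ "u \<otimes> v"]) (use carr S_mult in auto)
    then show "(case y1 of (a, s) \<Rightarrow> \<lambda>(b, t). loc_frac R S (a \<otimes> b) (s \<otimes> t)) y2 =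
        (case z1 of (a, s) \<Rightarrow> \<lambda>(b, t). loc_frac R S (a \<otimes> b) (s \<otimes> t)) z2"
      by simp
  qed
  from UN_equiv_class2[OF equiv_frac_rel equiv_frac_rel this, of "(a, s)" "(b, t)"] assms
  show ?thesis
    by (simp add: localization_def loc_frac_def case_prod_beta)
qed

lemma loc_add:
  assumes "a \<in> carrier R" "b \<in> carrier R" "s \<in> S" "t \<in> S"
  shows "loc_frac R S a s \<oplus>\<^bsub>localization R S\<^esub> loc_frac R S b t =
    loc_frac R S (a \<otimes> t \<oplus> b \<otimes> s) (s \<otimes> t)"
proof -
  have "congruent2 (frac_rel R S) (frac_rel R S)
    (\<lambda>(a, s) (b, t). loc_frac R S (a \<otimes> t \<oplus> b \<otimes> s) (s \<otimes> t))"
  proof (rule congruent2I')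
    fix y1 z1 y2 z2
    assume 1: "(y1, z1) \<in> frac_rel R S" and 2: "(y2, z2) \<in> frac_rel R S"
    obtain a s a' s' b t b' t' where
      [simp]: "y1 = (a, s)" "z1 = (a', s')" "y2 = (b, t)" "z2 = (b', t')"
      by (metis prod.exhaust)
    from 1 obtain u where u: "u \<in> S" "u \<otimes> (a \<otimes> s') = u \<otimes> (a' \<otimes> s)"
      and c1: "a \<in> carrier R" "a' \<in> carrier R" "s \<in> S" "s' \<in> S"
      by (auto simp: frac_rel_def)
    from 2 obtain v where v: "v \<in> S" "v \<otimes> (b \<otimes> t') = v \<otimes> (b' \<otimes> t)"
      and c2: "b \<in> carrier R" "b' \<in> carrier R" "t \<in> S" "t' \<in> S"
      by (auto simp: frac_rel_def)
    note carr = c1 c2 u(1) v(1) c1(3,4)[THEN S_carr] c2(3,4)[THEN S_carr] S_carr[OF u(1)] S_carr[OF v(1)]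
    have "(u \<otimes> v) \<otimes> ((a \<otimes> t \<oplus> b \<otimes> s) \<otimes> (s' \<otimes> t')) =
        (u \<otimes> (a \<otimes> s')) \<otimes> (v \<otimes> (t \<otimes> t')) \<oplus> (v \<otimes> (b \<otimes> t')) \<otimes> (u \<otimes> (s \<otimes> s'))"
      using carr by (simp add: m_ac l_distr r_distr)
    also have "\<dots> = (u \<otimes> v) \<otimes> ((a' \<otimes> t' \<oplus> b' \<otimes> s') \<otimes> (s \<otimes> t))"
      unfolding u(2) v(2) using carr by (simp add: m_ac l_distr r_distr)
    finally have "loc_frac R S (a \<otimes> t \<oplus> b \<otimes> s) (s \<otimes> t) =
        loc_frac R S (a' \<otimes> t' \<oplus> b' \<otimes> s') (s' \<otimes> t')"
      by (intro frac_eqI[of _ _ _ _ "u \<otimes> v"]) (use carr S_mult in auto)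
    then show "(case y1 of (a, s) \<Rightarrow> \<lambda>(b, t). loc_frac R S (a \<otimes> t \<oplus> b \<otimes> s) (s \<otimes> t)) y2 =
        (case z1 of (a, s) \<Rightarrow> \<lambda>(b, t). loc_frac R S (a \<otimes> t \<oplus> b \<otimes> s) (s \<otimes> t)) z2"
      by simp
  qed
  from UN_equiv_class2[OF equiv_frac_rel equiv_frac_rel this, of "(a, s)" "(b, t)"] assms
  show ?thesis
    by (simp add: localization_def loc_frac_def case_prod_beta)
qed

lemma loc_carrier:
  "x \<in> carrier (localization R S) \<longleftrightarrow> (\<exists>a \<in> carrier R. \<exists>s \<in> S. x = loc_frac R S a s)"
  by (auto simp: localization_def)

lemma loc_one: "\<one>\<^bsub>localization R S\<^esub> = loc_frac R S \<one> \<one>"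
  and loc_zero: "\<zero>\<^bsub>localization R S\<^esub> = loc_frac R S \<zero> \<one>"
  by (simp_all add: localization_def)

lemma cring_localization: "cring (localization R S)"
proof (rule cringI)
  show "abelian_group (localization R S)"
  proof (rule abelian_groupI)
    fix x assume "x \<in> carrier (localization R S)"
    then obtain a s where x: "a \<in> carrier R" "s \<in> S" "x = loc_frac R S a s"
      by (auto simp: loc_carrier)
    have "loc_frac R S (\<ominus> a \<otimes> s \<oplus> a \<otimes> s) (s \<otimes> s) = loc_frac R S \<zero> \<one>"
      by (rule frac_eqI') (use x S_one S_mult S_carr in \<open>auto simp: l_minus l_neg\<close>)
    then show "\<exists>y \<in> carrier (localization R S). y \<oplus>\<^bsub>localization R S\<^esub> x = \<zero>\<^bsub>localization R S\<^esub>"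
      using x by (intro bexI[of _ "loc_frac R S (\<ominus> a) s"]) (auto simp: loc_add loc_zero loc_carrier)
  qed (auto simp: loc_carrier loc_add loc_zero S_one S_carr S_mult m_ac a_ac l_distr r_distr
      intro!: bexI frac_eqI')
  show "comm_monoid (localization R S)"
    by (rule comm_monoidI)
      (auto simp: loc_carrier loc_mult loc_one S_one S_carr S_mult m_ac intro!: bexI frac_eqI')
next
  fix x y z
  assume "x \<in> carrier (localization R S)" "y \<in> carrier (localization R S)"
    "z \<in> carrier (localization R S)"
  then obtain a s b t c r where
    carr: "a \<in> carrier R" "s \<in> S" "b \<in> carrier R" "t \<in> S" "c \<in> carrier R" "r \<in> S"
    and [simp]: "x = loc_frac R S a s" "y = loc_frac R S b t" "z = loc_frac R S c r"
    unfolding loc_carrier by blast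
  have "loc_frac R S ((a \<otimes> t \<oplus> b \<otimes> s) \<otimes> c) ((s \<otimes> t) \<otimes> r) =
      loc_frac R S ((a \<otimes> c) \<otimes> (t \<otimes> r) \<oplus> (b \<otimes> c) \<otimes> (s \<otimes> r)) ((s \<otimes> r) \<otimes> (t \<otimes> r))"
  proof (rule frac_eqI')
    have c: "s \<in> carrier R" "t \<in> carrier R" "r \<in> carrier R"
      using carr S_carr by auto
    show "((a \<otimes> t \<oplus> b \<otimes> s) \<otimes> c) \<otimes> ((s \<otimes> r) \<otimes> (t \<otimes> r)) =
        ((a \<otimes> c) \<otimes> (t \<otimes> r) \<oplus> (b \<otimes> c) \<otimes> (s \<otimes> r)) \<otimes> ((s \<otimes> t) \<otimes> r)"
      using carr c by (simp add: m_ac l_distr r_distr)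
  qed (use carr S_carr S_mult in auto)
  then show "(x \<oplus>\<^bsub>localization R S\<^esub> y) \<otimes>\<^bsub>localization R S\<^esub> z =
      x \<otimes>\<^bsub>localization R S\<^esub> z \<oplus>\<^bsub>localization R S\<^esub> y \<otimes>\<^bsub>localization R S\<^esub> z"
    using carr by (simp add: loc_mult loc_add S_carr S_mult)
qed

end

lemma cring_localization_at:
  assumes "cring R" "primeideal P R"
  shows "cring (localization_at R P)"
proof -
  interpret P: primeideal P R by fact
  interpret mult_subset R "carrier R - P"
  proof (intro mult_subset.intro mult_subset_axioms.intro)
    show "\<one>\<^bsub>R\<^esub> \<in> carrier R - P"
      using P.I_notcarr P.one_imp_carrier P.one_closed by blast
    show "s \<otimes>\<^bsub>R\<^esub> t \<in> carrier R - P" if "s \<in> carrier R - P" "t \<in> carrier R - P" for s t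
      using that P.I_prime[of s t] P.m_closed[of s t] by blast
  qed (use assms in auto)
  show ?thesis
    by (rule cring_localization)
qed


section \<open>Weighted oriented graphs\<close>

record 'v wograph =
  verts :: "'v set"
  edges :: "('v \<times> 'v) set"
  weight :: "'v \<Rightarrow> nat"

definition is_source :: "'v wograph \<Rightarrow> 'v \<Rightarrow> bool" where
  "is_source D x \<longleftrightarrow> x \<in> verts D \<and> (\<forall>y. (y, x) \<notin> edges D)"

definition weighted_oriented_graph :: "'v wograph \<Rightarrow> bool" where
  "weighted_oriented_graph D \<longleftrightarrow>
     finite (verts D) \<and> edges D \<subseteq> verts D \<times> verts D \<and>
     (\<forall>x y. (x, y) \<in> edges D \<longrightarrow> x \<noteq> y \<and> (y, x) \<notin> edges D) \<and>
     (\<forall>x \<in> verts D. weight D x \<ge> 1) \<and>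
     (\<forall>x. is_source D x \<longrightarrow> weight D x = 1)"

definition nontrivial_verts :: "'v wograph \<Rightarrow> 'v set" where
  "nontrivial_verts D = {x \<in> verts D. weight D x \<noteq> 1}"

definition out_nbrs :: "'v wograph \<Rightarrow> 'v set \<Rightarrow> 'v set" where
  "out_nbrs D W = {y. \<exists>x \<in> W. (x, y) \<in> edges D}"

definition induced_subgraph :: "'v wograph \<Rightarrow> 'v wograph \<Rightarrow> bool" where
  "induced_subgraph D' D \<longleftrightarrow>
     verts D' \<subseteq> verts D \<and> edges D' = edges D \<inter> verts D' \<times> verts D' \<and>
     (\<forall>x \<in> verts D'. weight D' x = (if is_source D' x then 1 else weight D x))"

definition underlying_edges :: "'v wograph \<Rightarrow> 'v set set" where
  "underlying_edges D = {{x, y} | x y. (x, y) \<in> edges D}"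

definition underlying_cycle :: "'v wograph \<Rightarrow> 'v list \<Rightarrow> bool" where
  "underlying_cycle D xs \<longleftrightarrow>
     length xs \<ge> 3 \<and> distinct xs \<and> verts D = set xs \<and>
     underlying_edges D = {{xs ! i, xs ! (Suc i mod length xs)} | i. i < length xs}"

definition edge_ideal :: "'v wograph \<Rightarrow> (('v \<Rightarrow>\<^sub>0 nat) \<Rightarrow>\<^sub>0 'k::field) set" where
  "edge_ideal D = genideal (poly_ring (verts D)) {pvar x * pvar y ^ weight D y | x y. (x, y) \<in> edges D}"

end

theory Submission
  imports Defs
begin

text \<open>The separating element is the monomial \<open>f = \<Prod>x x\<^bsup>w'(x)\<^esup>\<close> over the cycle, with the weights
  \<open>w'\<close> of \<open>D'\<close>. Deleting any vertex \<open>x\<close> of the odd cycle leaves a path with a perfect matching, so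
  \<open>f\<close> is \<open>x\<^bsup>w'(x)\<^esup>\<close> times an element of \<open>I\<^sup>n\<close>. Hence \<open>f\<close> lies in \<open>I\<^bsup>n+1\<^esup>R\<^sub>P\<close> as soon as
  \<open>x\<^bsup>w'(x)\<^esup>\<close> lies in \<open>IR\<^sub>P\<close> for some \<open>x\<close>. If a cycle vertex is outside \<open>P\<close>, take \<open>x\<close> to be its
  neighbour; if all of them are in \<open>P\<close>, take for \<open>x\<close> the distinguished vertex, which has a neighbour
  (possibly off the cycle) outside \<open>P\<close>. On the other hand \<open>n + 1\<close> edge monomials cannot fit into \<open>f\<close>,
  since their edges would be pairwise disjoint.\<close>

section \<open>Monomial ideals described by exponents\<close>

abbreviation monom_of :: "('v \<Rightarrow>\<^sub>0 nat) \<Rightarrow> ('v \<Rightarrow>\<^sub>0 nat) \<Rightarrow>\<^sub>0 'k::field" where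
  "monom_of a \<equiv> Poly_Mapping.single a 1"

text \<open>Membership is tested on each monomial of the support separately, with divisibility
  written as addition of exponents. Questions about the edge ideal and its powers thereby become
  questions about exponent vectors.\<close>

definition monomial_ideal :: "'v set \<Rightarrow> ('v \<Rightarrow>\<^sub>0 nat) set \<Rightarrow> (('v \<Rightarrow>\<^sub>0 nat) \<Rightarrow>\<^sub>0 'k::field) set" where
  "monomial_ideal V A =
     {p \<in> carrier (poly_ring V). \<forall>m \<in> Poly_Mapping.keys p. \<exists>a \<in> A. \<exists>c. m = a + c}"

lemma poly_ring_simps [simp]:
  "p \<otimes>\<^bsub>poly_ring V\<^esub> q = p * q" "p \<oplus>\<^bsub>poly_ring V\<^esub> q = p + q"
  "\<one>\<^bsub>poly_ring V\<^esub> = 1" "\<zero>\<^bsub>poly_ring V\<^esub> = 0"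
  by (simp_all add: poly_ring_def)

lemma poly_ring_carrier:
  "p \<in> carrier (poly_ring V) \<longleftrightarrow> (\<forall>m \<in> Poly_Mapping.keys p. Poly_Mapping.keys m \<subseteq> V)"
  by (simp add: poly_ring_def)

lemma keys_add_nat:
  fixes a b :: "'v \<Rightarrow>\<^sub>0 nat"
  shows "Poly_Mapping.keys (a + b) = Poly_Mapping.keys a \<union> Poly_Mapping.keys b"
  by (auto simp: in_keys_iff lookup_add)

lemma exists_add_if_lookup_le:
  fixes a m :: "'v \<Rightarrow>\<^sub>0 nat"
  assumes "\<And>v. Poly_Mapping.lookup a v \<le> Poly_Mapping.lookup m v"
  shows "\<exists>c. m = a + c"
proof
  show "m = a + (m - a)"
    by (rule poly_mapping_eqI) (simp add: lookup_add lookup_minus assms)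
qed

lemma lookup_monom_of_times:
  fixes p :: "('v \<Rightarrow>\<^sub>0 nat) \<Rightarrow>\<^sub>0 'k::field"
  shows "Poly_Mapping.lookup (monom_of a * p) (a + m) = Poly_Mapping.lookup p m"
  by (simp add: lookup_mult lookup_single when_mult)

lemma ideal_monomial_ideal:
  "ideal (monomial_ideal V A :: (('v \<Rightarrow>\<^sub>0 nat) \<Rightarrow>\<^sub>0 'k::field) set) (poly_ring V)"
    (is "ideal ?M ?R")
proof -
  interpret R: cring ?R by (rule cring_poly_ring)
  have l: "x * p \<in> ?M" if p: "p \<in> ?M" and x: "x \<in> carrier ?R" for p x
  proof -
    have "\<exists>a\<in>A. \<exists>c. m = a + c" if "m \<in> Poly_Mapping.keys (x * p)" for m
    proof -
      have "m \<in> {a + b | a b. a \<in> Poly_Mapping.keys x \<and> b \<in> Poly_Mapping.keys p}"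
        using keys_mult[of x p] that by blast
      then obtain b c where m: "m = b + c" "c \<in> Poly_Mapping.keys p" by blast
      with p obtain a d where "a \<in> A" "c = a + d" unfolding monomial_ideal_def by blast
      with m have "m = a + (d + b)" by (simp add: ac_simps)
      with \<open>a \<in> A\<close> show ?thesis by blast
    qed
    moreover have "x * p \<in> carrier ?R"
      using R.m_closed[of x p] p x by (simp add: monomial_ideal_def)
    ultimately show ?thesis by (simp add: monomial_ideal_def)
  qed
  have neg: "- p \<in> ?M" if "p \<in> ?M" for p
    using that by (simp add: monomial_ideal_def poly_ring_carrier)
  have add: "p + q \<in> ?M" if "p \<in> ?M" "q \<in> ?M" for p q
    using that Poly_Mapping.keys_add[of p q]
    unfolding monomial_ideal_def poly_ring_carrier by blast
  show ?thesis
  proof (rule idealI)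
    show "subgroup ?M (add_monoid ?R)"
    proof (rule R.add.subgroupI)
      show "?M \<subseteq> carrier ?R" by (auto simp: monomial_ideal_def)
      have "0 \<in> ?M" by (simp add: monomial_ideal_def poly_ring_carrier)
      then show "?M \<noteq> {}" by blast
      fix p assume p: "p \<in> ?M"
      have "\<ominus>\<^bsub>?R\<^esub> p = - p"
        by (rule R.minus_equality) (use p neg in \<open>auto simp: monomial_ideal_def\<close>)
      with neg[OF p] show "\<ominus>\<^bsub>?R\<^esub> p \<in> ?M" by simp
    qed (use add in simp)
  qed (use l R.ring_axioms in \<open>auto simp: mult.commute\<close>)
qed

text \<open>A polynomial is the finite sum of its terms, and each term is a multiple of some
  \<open>monom_of a\<close> with \<open>a\<close> in \<open>A\<close>, by a one-term cofactor that
  carries the coefficient and again uses only variables from \<open>V\<close>.\<close>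

lemma monomial_ideal_least:
  fixes J :: "(('v \<Rightarrow>\<^sub>0 nat) \<Rightarrow>\<^sub>0 'k::field) set"
  assumes J: "ideal J (poly_ring V)" and gens: "\<And>a. a \<in> A \<Longrightarrow> monom_of a \<in> J"
  shows "monomial_ideal V A \<subseteq> J"
proof
  interpret J: ideal J "poly_ring V" by fact
  fix p :: "('v \<Rightarrow>\<^sub>0 nat) \<Rightarrow>\<^sub>0 'k" assume p: "p \<in> monomial_ideal V A"
  have mon: "Poly_Mapping.single m (Poly_Mapping.lookup p m) \<in> J" if m: "m \<in> Poly_Mapping.keys p" for m
  proof -
    from p m obtain a c where a: "a \<in> A" "m = a + c" unfolding monomial_ideal_def by blast
    have "Poly_Mapping.keys m \<subseteq> V" using p m by (auto simp: monomial_ideal_def poly_ring_carrier)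
    with a have "Poly_Mapping.single c (Poly_Mapping.lookup p m) \<in> carrier (poly_ring V)"
      by (auto simp: poly_ring_carrier keys_add_nat)
    from J.I_r_closed[OF gens[OF a(1)] this] a show ?thesis by (simp add: mult_single)
  qed
  have "(\<Sum>m\<in>S. Poly_Mapping.single m (Poly_Mapping.lookup p m)) \<in> J"
    if "finite S" "S \<subseteq> Poly_Mapping.keys p" for S
    using that
  proof (induction S rule: finite_induct)
    case empty
    then show ?case using additive_subgroup.zero_closed[OF J.is_additive_subgroup] by simp
  next
    case (insert m S)
    then show ?case using additive_subgroup.a_closed[OF J.is_additive_subgroup mon[of m]] by simp
  qed
  moreover have "p = (\<Sum>m\<in>Poly_Mapping.keys p. Poly_Mapping.single m (Poly_Mapping.lookup p m))"
    by (rule poly_mapping_eqI) (simp add: lookup_sum lookup_single when_def in_keys_iff)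
  ultimately show "p \<in> J" by (metis finite_keys order_refl)
qed

lemma monom_of_mem_monomial_ideal:
  "monom_of m \<in> monomial_ideal V A \<longleftrightarrow>
     Poly_Mapping.keys m \<subseteq> V \<and> (\<exists>a \<in> A. \<exists>c. m = a + c)"
  by (simp add: monomial_ideal_def poly_ring_carrier)

lemma generator_mem_monomial_ideal:
  assumes "a \<in> A" "Poly_Mapping.keys a \<subseteq> V"
  shows "monom_of a \<in> monomial_ideal V A"
  unfolding monom_of_mem_monomial_ideal using assms add_0_right[of a, symmetric] by blast

lemma genideal_monomials:
  fixes A :: "('v \<Rightarrow>\<^sub>0 nat) set"
  assumes "\<And>a. a \<in> A \<Longrightarrow> Poly_Mapping.keys a \<subseteq> V"
  shows "genideal (poly_ring V) (monom_of ` A :: (('v \<Rightarrow>\<^sub>0 nat) \<Rightarrow>\<^sub>0 'k::field) set) = monomial_ideal V A"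
    (is "genideal ?R ?S = ?M")
proof -
  interpret R: cring ?R by (rule cring_poly_ring)
  have S: "?S \<subseteq> ?M"
    using assms by (auto intro: generator_mem_monomial_ideal)
  then have "?S \<subseteq> carrier ?R" by (auto simp: monomial_ideal_def)
  from monomial_ideal_least[OF R.genideal_ideal[OF this]] R.genideal_self[OF this]
  have "?M \<subseteq> genideal ?R ?S" by blast
  with R.genideal_minimal[OF ideal_monomial_ideal S] show ?thesis by blast
qed

section \<open>Products and powers of monomial ideals\<close>

definition exponent_sums :: "('v \<Rightarrow>\<^sub>0 nat) set \<Rightarrow> nat \<Rightarrow> ('v \<Rightarrow>\<^sub>0 nat) set" where
  "exponent_sums A k = {\<Sum>i<k. g i | g. \<forall>i<k. g i \<in> A}"

lemma exponent_sums_0 [simp]: "exponent_sums A 0 = {0}"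
  by (simp add: exponent_sums_def)

lemma exponent_sums_Suc: "exponent_sums A (Suc k) = {a + b | a b. a \<in> exponent_sums A k \<and> b \<in> A}"
proof (intro equalityI subsetI)
  fix m assume "m \<in> exponent_sums A (Suc k)"
  then obtain g where "m = (\<Sum>i<k. g i) + g k" "\<forall>i<Suc k. g i \<in> A"
    by (auto simp: exponent_sums_def)
  then show "m \<in> {a + b | a b. a \<in> exponent_sums A k \<and> b \<in> A}"
    unfolding exponent_sums_def by (intro CollectI exI[of _ "\<Sum>i<k. g i"] exI[of _ "g k"]) auto
next
  fix m assume "m \<in> {a + b | a b. a \<in> exponent_sums A k \<and> b \<in> A}"
  then obtain g b where m: "m = (\<Sum>i<k. g i) + b" "\<forall>i<k. g i \<in> A" "b \<in> A"
    by (auto simp: exponent_sums_def)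
  then have "m = (\<Sum>i<Suc k. (g(k := b)) i)" "\<forall>i<Suc k. (g(k := b)) i \<in> A"
    by (auto simp: less_Suc_eq)
  then show "m \<in> exponent_sums A (Suc k)"
    unfolding exponent_sums_def by blast
qed

text \<open>Each monomial of \<open>i * j\<close> is a monomial of \<open>i\<close> times one of
  \<open>j\<close>, hence divisible by a product of two generators; conversely each such product is
  itself a generator of the product ideal, and minimality of monomial ideals applies.\<close>

lemma ideal_prod_monomial_ideal:
  fixes A B :: "('v \<Rightarrow>\<^sub>0 nat) set"
  assumes A: "\<And>a. a \<in> A \<Longrightarrow> Poly_Mapping.keys a \<subseteq> V" and B: "\<And>b. b \<in> B \<Longrightarrow> Poly_Mapping.keys b \<subseteq> V"
  shows "ideal_prod (poly_ring V) (monomial_ideal V A) (monomial_ideal V B) =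
    (monomial_ideal V {a + b | a b. a \<in> A \<and> b \<in> B} :: (('v \<Rightarrow>\<^sub>0 nat) \<Rightarrow>\<^sub>0 'k::field) set)"
    (is "ideal_prod ?R ?I ?J = ?M")
proof
  interpret R: cring ?R by (rule cring_poly_ring)
  interpret I: ideal ?I ?R by (rule ideal_monomial_ideal)
  interpret J: ideal ?J ?R by (rule ideal_monomial_ideal)
  interpret M: ideal ?M ?R by (rule ideal_monomial_ideal)
  show "ideal_prod ?R ?I ?J \<subseteq> ?M"
  proof
    fix p assume "p \<in> ideal_prod ?R ?I ?J"
    then show "p \<in> ?M"
    proof (induction rule: ideal_prod.induct)
      case (prod i j)
      have "\<exists>a\<in>{a + b | a b. a \<in> A \<and> b \<in> B}. \<exists>c. m = a + c" if "m \<in> Poly_Mapping.keys (i * j)" for m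
      proof -
        have "m \<in> {a + b | a b. a \<in> Poly_Mapping.keys i \<and> b \<in> Poly_Mapping.keys j}"
          using keys_mult[of i j] that by blast
        then obtain x y where m: "m = x + y" "x \<in> Poly_Mapping.keys i" "y \<in> Poly_Mapping.keys j"
          by blast
        with prod obtain a c b d where "a \<in> A" "x = a + c" "b \<in> B" "y = b + d"
          unfolding monomial_ideal_def by blast
        moreover from this m have "m = (a + b) + (c + d)" by (simp add: ac_simps)
        ultimately show ?thesis by blast
      qed
      moreover have "i * j \<in> carrier ?R"
        using R.m_closed[OF I.Icarr[OF prod(1)] J.Icarr[OF prod(2)]] by simp
      ultimately show ?case unfolding monomial_ideal_def poly_ring_simps by blast
    next
      case (sum s1 s2)
      then show ?case using additive_subgroup.a_closed[OF M.is_additive_subgroup] by blast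
    qed
  qed
  show "?M \<subseteq> ideal_prod ?R ?I ?J"
  proof (rule monomial_ideal_least)
    show "ideal (ideal_prod ?R ?I ?J) ?R"
      by (intro R.ideal_prod_is_ideal ideal_monomial_ideal)
    fix m assume "m \<in> {a + b | a b. a \<in> A \<and> b \<in> B}"
    then obtain a b where m: "m = a + b" "a \<in> A" "b \<in> B" by blast
    then have "monom_of a \<in> ?I" "monom_of b \<in> ?J"
      using A B by (auto intro: generator_mem_monomial_ideal)
    from ideal_prod.prod[OF this, of ?R] show "monom_of m \<in> ideal_prod ?R ?I ?J"
      by (simp add: m mult_single)
  qed
qed

lemma keys_exponent_sums:
  assumes "\<And>a. a \<in> A \<Longrightarrow> Poly_Mapping.keys a \<subseteq> V" "b \<in> exponent_sums A k"
  shows "Poly_Mapping.keys b \<subseteq> V"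
  using assms(2)
proof (induction k arbitrary: b)
  case (Suc k)
  then show ?case using assms(1) unfolding exponent_sums_Suc by (fastforce simp: keys_add_nat)
qed simp

lemma ideal_power_monomial_ideal:
  fixes A :: "('v \<Rightarrow>\<^sub>0 nat) set"
  assumes "\<And>a. a \<in> A \<Longrightarrow> Poly_Mapping.keys a \<subseteq> V"
  shows "ideal_power (poly_ring V) (monomial_ideal V A :: (('v \<Rightarrow>\<^sub>0 nat) \<Rightarrow>\<^sub>0 'k::field) set) k =
    monomial_ideal V (exponent_sums A k)"
proof -
  let ?R = "poly_ring V :: (('v \<Rightarrow>\<^sub>0 nat) \<Rightarrow>\<^sub>0 'k) ring"
  interpret R: cring ?R by (rule cring_poly_ring)
  interpret S: comm_monoid "ideals_set ?R" by (rule R.ideals_set_is_comm_monoid)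
  show ?thesis
  proof (induction k)
    case 0
    \<comment> \<open>The zeroth power is the whole ring, and the only exponent sum of length 0 is
      0, which divides every monomial.\<close>
    show ?case by (simp add: ideal_power_def ideals_set_def monomial_ideal_def)
  next
    case (Suc k)
    have "ideal_power ?R (monomial_ideal V A) (Suc k) =
        ideal_prod ?R (ideal_power ?R (monomial_ideal V A) k) (monomial_ideal V A)"
      by (simp add: ideal_power_def ideals_set_def)
    also have "\<dots> = monomial_ideal V (exponent_sums A (Suc k))"
      unfolding Suc exponent_sums_Suc
      by (rule ideal_prod_monomial_ideal) (use assms keys_exponent_sums in blast)+
    finally show ?case .
  qed
qed

section \<open>Contraction from a localization, and associated primes as colon ideals\<close>

lemma mem_loc_contractionI:
  assumes "cring R" "primeideal P R" "J \<subseteq> carrier R" "f \<in> carrier R"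
    and s: "s \<in> carrier R - P" and sf: "s \<otimes>\<^bsub>R\<^esub> f \<in> J"
  shows "f \<in> loc_contraction R P J"
proof -
  let ?S = "carrier R - P"
  let ?L = "localization R ?S"
  interpret P: primeideal P R by fact
  interpret mult_subset R ?S
  proof (intro mult_subset.intro mult_subset_axioms.intro)
    show "\<one>\<^bsub>R\<^esub> \<in> ?S"
      using P.I_notcarr P.one_imp_carrier P.one_closed by blast
    show "s \<otimes>\<^bsub>R\<^esub> t \<in> ?S" if "s \<in> ?S" "t \<in> ?S" for s t
      using that P.I_prime[of s t] P.m_closed[of s t] by blast
  qed (use assms in auto)
  interpret L: cring ?L by (rule cring_localization)
  have sub: "loc_map R P ` J \<subseteq> carrier ?L"
  proof
    fix X assume "X \<in> loc_map R P ` J"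
    then obtain a where "a \<in> J" "X = loc_frac R ?S a \<one>\<^bsub>R\<^esub>" by (auto simp: loc_map_def)
    with assms(3) S_one show "X \<in> carrier ?L" unfolding loc_carrier by blast
  qed
  interpret G: ideal "genideal ?L (loc_map R P ` J)" ?L
    by (rule L.genideal_ideal[OF sub])
  \<comment> \<open>The identity behind this is f/1 = (1/s)(sf/1), where 1/s exists because
    \<open>s\<close> lies outside \<open>P\<close>.\<close>
  have "loc_frac R ?S \<one>\<^bsub>R\<^esub> s \<otimes>\<^bsub>?L\<^esub> loc_map R P (s \<otimes>\<^bsub>R\<^esub> f) \<in> genideal ?L (loc_map R P ` J)"
  proof (rule G.I_l_closed)
    show "loc_map R P (s \<otimes>\<^bsub>R\<^esub> f) \<in> genideal ?L (loc_map R P ` J)"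
      using L.genideal_self[OF sub] sf by blast
    show "loc_frac R ?S \<one>\<^bsub>R\<^esub> s \<in> carrier ?L" using s by (auto simp: loc_carrier)
  qed
  moreover have "loc_frac R ?S \<one>\<^bsub>R\<^esub> s \<otimes>\<^bsub>?L\<^esub> loc_map R P (s \<otimes>\<^bsub>R\<^esub> f) =
      loc_frac R ?S (\<one>\<^bsub>R\<^esub> \<otimes>\<^bsub>R\<^esub> (s \<otimes>\<^bsub>R\<^esub> f)) (s \<otimes>\<^bsub>R\<^esub> \<one>\<^bsub>R\<^esub>)"
    unfolding loc_map_def by (rule loc_mult) (use s assms(4) S_one in auto)
  moreover have "\<dots> = loc_map R P f"
    unfolding loc_map_def by (rule frac_eqI') (use s assms(4) S_one in \<open>auto simp: P.m_comm\<close>)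
  ultimately show ?thesis using assms(4) by (simp add: loc_contraction_def)
qed

text \<open>The residue class annihilated exactly by \<open>P\<close> is lifted to a representative
  \<open>q\<close>, which turns \<open>P\<close> into the colon ideal (I : q) and removes the
  quotient ring from later arguments.\<close>

lemma Ass_colon:
  assumes "ideal I R" "P \<in> Ass R I"
  obtains q where "q \<in> carrier R" "P = {r \<in> carrier R. r \<otimes>\<^bsub>R\<^esub> q \<in> I}"
proof -
  interpret I: ideal I R by fact
  from assms(2) obtain m where m: "m \<in> carrier (R Quot I)"
    and P: "P = {r \<in> carrier R. (I +>\<^bsub>R\<^esub> r) \<otimes>\<^bsub>R Quot I\<^esub> m = \<zero>\<^bsub>R Quot I\<^esub>}"
    unfolding Ass_def by blast
  from m obtain q where q: "q \<in> carrier R" "m = I +>\<^bsub>R\<^esub> q"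
    by (auto simp: FactRing_def A_RCOSETS_def')
  have "(I +>\<^bsub>R\<^esub> r) \<otimes>\<^bsub>R Quot I\<^esub> m = \<zero>\<^bsub>R Quot I\<^esub> \<longleftrightarrow> r \<otimes>\<^bsub>R\<^esub> q \<in> I" if "r \<in> carrier R" for r
    using that q I.rcos_const_imp_mem[of "r \<otimes>\<^bsub>R\<^esub> q"] I.a_rcos_const[of "r \<otimes>\<^bsub>R\<^esub> q"]
    by (auto simp: FactRing_def I.rcoset_mult_add)
  with P q that show ?thesis by blast
qed

section \<open>The edge ideal and the primes associated to it\<close>

definition edge_exponent :: "'v wograph \<Rightarrow> 'v \<times> 'v \<Rightarrow> 'v \<Rightarrow>\<^sub>0 nat" where
  "edge_exponent D e = Poly_Mapping.single (fst e) 1 + Poly_Mapping.single (snd e) (weight D (snd e))"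

lemma lookup_edge_exponent:
  "Poly_Mapping.lookup (edge_exponent D (x, y)) z =
     (if z = x then 1 else 0) + (if z = y then weight D y else 0)"
  by (simp add: edge_exponent_def lookup_add lookup_single when_def)

lemma pvar_power: "pvar v ^ k = monom_of (Poly_Mapping.single v k)"
  by (induction k) (simp_all add: pvar_def mult_single flip: single_add)

lemma keys_edge_exponent:
  assumes "weighted_oriented_graph D" "e \<in> edges D"
  shows "Poly_Mapping.keys (edge_exponent D e) \<subseteq> verts D"
  using assms unfolding weighted_oriented_graph_def edge_exponent_def
  by (auto simp: keys_add_nat split: if_splits)

lemma edge_ideal_eq_monomial_ideal:
  fixes D :: "'v wograph"
  assumes "weighted_oriented_graph D"
  shows "(edge_ideal D :: (('v \<Rightarrow>\<^sub>0 nat) \<Rightarrow>\<^sub>0 'k::field) set) =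
    monomial_ideal (verts D) (edge_exponent D ` edges D)"
proof -
  have "pvar x * pvar y ^ weight D y = (monom_of (edge_exponent D (x, y)) :: _ \<Rightarrow>\<^sub>0 'k)" for x y
    by (simp add: pvar_power mult_single edge_exponent_def) (simp add: pvar_def mult_single)
  then have eq: "{pvar x * pvar y ^ weight D y | x y. (x, y) \<in> edges D} =
      (monom_of ` edge_exponent D ` edges D :: (('v \<Rightarrow>\<^sub>0 nat) \<Rightarrow>\<^sub>0 'k) set)"
    by (fastforce simp: image_iff)
  show ?thesis
    unfolding edge_ideal_def eq
    by (rule genideal_monomials) (use keys_edge_exponent[OF assms] in blast)
qed

lemma pvar_carrier: "v \<in> V \<Longrightarrow> pvar v \<in> carrier (poly_ring V)"
  by (simp add: pvar_def poly_ring_carrier)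

text \<open>Supplies the denominators for the localization at \<open>P\<close>. Primality gives the
  induction step, and the exponent 0 is covered because a prime ideal is proper.\<close>

lemma monom_power_notin_prime:
  fixes P :: "(('v \<Rightarrow>\<^sub>0 nat) \<Rightarrow>\<^sub>0 'k::field) set"
  assumes "primeideal P (poly_ring V)" "v \<in> V" "pvar v \<notin> P"
  shows "monom_of (Poly_Mapping.single v k) \<notin> P"
proof -
  interpret P: primeideal P "poly_ring V" by fact
  have carr: "pvar v ^ k \<in> carrier (poly_ring V)" for k
    using assms(2) by (simp add: pvar_power poly_ring_carrier)
  have "pvar v ^ k \<notin> P"
  proof (induction k)
    case 0
    show ?case using P.I_notcarr P.one_imp_carrier by auto
  next
    case (Suc k)
    with P.I_prime[OF pvar_carrier[OF assms(2)] carr[of k]] assms(3) show ?case by auto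
  qed
  then show ?thesis by (simp add: pvar_power)
qed

text \<open>Write \<open>P = (I : q)\<close> and let \<open>\<mu>\<close> be a monomial of \<open>q\<close> outside \<open>I\<close>; then \<open>x \<mu> \<in> I\<close> for every
  variable \<open>x \<in> P\<close>. If an edge monomial on \<open>v, y\<close> divides \<open>v \<mu>\<close>, the exponent of \<open>y\<close> in \<open>\<mu>\<close> is already
  large enough that multiplying by \<open>y\<close> creates no new divisor, so \<open>y \<notin> P\<close>. When the edge points
  to \<open>v\<close>, this uses that \<open>y\<close> has weight 1.\<close>

lemma associated_prime_misses_neighbour:
  fixes D :: "'v wograph" and P :: "(('v \<Rightarrow>\<^sub>0 nat) \<Rightarrow>\<^sub>0 'k::field) set"
  assumes D: "weighted_oriented_graph D" and P: "P \<in> Ass (poly_ring (verts D)) (edge_ideal D)"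
    and v: "v \<in> verts D" "pvar v \<in> P" "v \<notin> out_nbrs D (nontrivial_verts D)"
  obtains y where "y \<in> verts D" "pvar y \<notin> P" "(v, y) \<in> edges D \<or> (y, v) \<in> edges D"
proof -
  let ?R = "poly_ring (verts D) :: (('v \<Rightarrow>\<^sub>0 nat) \<Rightarrow>\<^sub>0 'k) ring"
  let ?E = "edge_exponent D ` edges D"
  let ?I = "monomial_ideal (verts D) ?E :: (('v \<Rightarrow>\<^sub>0 nat) \<Rightarrow>\<^sub>0 'k) set"
  have inV: "x \<in> verts D" "y \<in> verts D" "x \<noteq> y" "weight D y \<ge> 1" if "(x, y) \<in> edges D" for x y
    using D that unfolding weighted_oriented_graph_def by auto
  interpret P: primeideal P ?R using P by (simp add: Ass_def)
  obtain q where q: "q \<in> carrier ?R" "P = {r \<in> carrier ?R. r * q \<in> ?I}"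
    using Ass_colon[OF ideal_monomial_ideal P[unfolded edge_ideal_eq_monomial_ideal[OF D]]]
    unfolding poly_ring_simps by blast
  have "1 \<notin> P" and "1 \<in> carrier ?R"
    using P.I_notcarr P.one_imp_carrier P.one_closed by auto
  then have "q \<notin> ?I"
    unfolding q(2) by simp
  then obtain \<mu> where \<mu>: "\<mu> \<in> Poly_Mapping.keys q" "\<And>a c. a \<in> ?E \<Longrightarrow> \<mu> \<noteq> a + c"
    using q unfolding monomial_ideal_def by blast
  \<comment> \<open>Multiplication by a variable shifts the support injectively, so x \<mu> really
    occurs in \<open>pvar x * q\<close>, an element of the ideal. Some edge monomial thus divides x
    \<mu> but not \<mu>, and divisibility of \<mu> can fail only at \<open>x\<close>.\<close>
  have new_divisor: "\<exists>a b. (a, b) \<in> edges D \<and>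
      (\<forall>z. z \<noteq> x \<longrightarrow> Poly_Mapping.lookup (edge_exponent D (a, b)) z \<le> Poly_Mapping.lookup \<mu> z) \<and>
      Poly_Mapping.lookup \<mu> x < Poly_Mapping.lookup (edge_exponent D (a, b)) x"
    if x: "pvar x \<in> P" for x
  proof -
    have "Poly_Mapping.single x 1 + \<mu> \<in> Poly_Mapping.keys (pvar x * q)"
      using \<mu>(1) by (simp add: pvar_def in_keys_iff lookup_monom_of_times)
    moreover have "pvar x * q \<in> ?I" using x unfolding q(2) by blast
    ultimately obtain e' c where "e' \<in> edges D" "Poly_Mapping.single x 1 + \<mu> = edge_exponent D e' + c"
      unfolding monomial_ideal_def by blast
    then obtain a b where e: "(a, b) \<in> edges D"
      "Poly_Mapping.single x 1 + \<mu> = edge_exponent D (a, b) + c"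
      by (cases e') auto
    have le: "Poly_Mapping.lookup (edge_exponent D (a, b)) z \<le> Poly_Mapping.lookup \<mu> z"
      if "z \<noteq> x" for z
      using arg_cong[OF e(2), of "\<lambda>m. Poly_Mapping.lookup m z"] that
      by (simp add: lookup_add lookup_single when_def)
    have "\<not> (\<forall>z. Poly_Mapping.lookup (edge_exponent D (a, b)) z \<le> Poly_Mapping.lookup \<mu> z)"
      using exists_add_if_lookup_le[of "edge_exponent D (a, b)" \<mu>] \<mu>(2) e(1) by blast
    with le e(1) show ?thesis by (metis not_le)
  qed
  from new_divisor[OF v(2)] obtain a b where ab: "(a, b) \<in> edges D"
    and le: "\<And>z. z \<noteq> v \<Longrightarrow> Poly_Mapping.lookup (edge_exponent D (a, b)) z \<le> Poly_Mapping.lookup \<mu> z"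
    and lt: "Poly_Mapping.lookup \<mu> v < Poly_Mapping.lookup (edge_exponent D (a, b)) v"
    by blast
  consider "v = a" | "v = b" using lt by (auto simp: lookup_edge_exponent split: if_splits)
  then show ?thesis
  proof cases
    case 1
    \<comment> \<open>Since \<open>b\<close> differs from \<open>v\<close>, the exponent of
      \<open>b\<close> in \<mu> is at least \<open>weight D b\<close>. No edge monomial has a larger
      exponent there: it is 1 at a tail and \<open>weight D b\<close> at a head.\<close>
    have "pvar b \<notin> P"
    proof
      assume "pvar b \<in> P"
      from new_divisor[OF this] obtain c d where "(c, d) \<in> edges D"
        "Poly_Mapping.lookup \<mu> b < Poly_Mapping.lookup (edge_exponent D (c, d)) b"
        by blast
      with inV[of c d] inV[OF ab] le[of b] 1 show False
        by (auto simp: lookup_edge_exponent split: if_splits)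
    qed
    with that ab 1 inV show ?thesis by blast
  next
    case 2
    have "weight D a = 1"
      using v(3) 2 ab inV[OF ab] unfolding out_nbrs_def nontrivial_verts_def by blast
    have "pvar a \<notin> P"
    proof
      assume "pvar a \<in> P"
      from new_divisor[OF this] obtain c d where "(c, d) \<in> edges D"
        "Poly_Mapping.lookup \<mu> a < Poly_Mapping.lookup (edge_exponent D (c, d)) a"
        by blast
      with inV[of c d] inV[OF ab] le[of a] 2 \<open>weight D a = 1\<close> show False
        by (auto simp: lookup_edge_exponent split: if_splits)
    qed
    with that ab 2 inV show ?thesis by blast
  qed
qed

section \<open>Neighbours and sources on a cycle\<close>

lemma underlying_cycle_neighbours:
  assumes cyc: "underlying_cycle D xs" and i: "i < length xs"
    and adj: "(xs ! i, z) \<in> edges D \<or> (z, xs ! i) \<in> edges D"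
  shows "z = xs ! (Suc i mod length xs) \<or> z = xs ! (if i = 0 then length xs - 1 else i - 1)"
proof -
  have "{xs ! i, z} \<in> underlying_edges D"
    using adj unfolding underlying_edges_def by (auto simp: doubleton_eq_iff)
  then obtain j where j: "j < length xs" "{xs ! i, z} = {xs ! j, xs ! (Suc j mod length xs)}"
    using cyc unfolding underlying_cycle_def by blast
  have dist: "distinct xs" using cyc by (simp add: underlying_cycle_def)
  from j(2) consider "xs ! i = xs ! j" "z = xs ! (Suc j mod length xs)"
    | "xs ! i = xs ! (Suc j mod length xs)" "z = xs ! j"
    by (auto simp: doubleton_eq_iff)
  then show ?thesis
  proof cases
    case 1
    with dist i j show ?thesis by (simp add: nth_eq_iff_index_eq)
  next
    case 2
    have "Suc j mod length xs < length xs" using j(1) by (intro mod_less_divisor) linarith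
    with 2 dist i j(1) have "i = Suc j mod length xs" by (simp add: nth_eq_iff_index_eq)
    \<comment> \<open>The wrap-around edge, \<open>Suc j = length xs\<close>, is exactly the case
      \<open>i = 0\<close>.\<close>
    with j(1) have "j = (if i = 0 then length xs - 1 else i - 1)"
      by (cases "Suc j = length xs") auto
    with 2 show ?thesis by simp
  qed
qed

text \<open>A cycle vertex has at most two neighbours. Two out-neighbours exhaust them, and since no
  edge is oriented both ways an in-neighbour would be a third.\<close>

lemma two_out_neighbours_imp_source:
  assumes D: "weighted_oriented_graph D" and ind: "induced_subgraph D' D"
    and cyc: "underlying_cycle D' xs"
    and "(a, b) \<in> edges D'" "(a, c) \<in> edges D'" "b \<noteq> c"
  shows "is_source D' a"
proof -
  have asym: "(y, x) \<notin> edges D'" if "(x, y) \<in> edges D'" for x y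
    using that D ind unfolding weighted_oriented_graph_def induced_subgraph_def by blast
  have "a \<in> verts D'" using assms(4) ind unfolding induced_subgraph_def by blast
  then obtain i where i: "i < length xs" "a = xs ! i"
    using cyc unfolding underlying_cycle_def by (metis in_set_conv_nth)
  have "(z, a) \<notin> edges D'" for z
  proof
    assume z: "(z, a) \<in> edges D'"
    then have "z \<noteq> b" "z \<noteq> c" using asym assms(4,5) by blast+
    with underlying_cycle_neighbours[OF cyc i(1), of b] underlying_cycle_neighbours[OF cyc i(1), of c]
      underlying_cycle_neighbours[OF cyc i(1), of z] assms(4-6) z i(2)
    show False by auto
  qed
  with \<open>a \<in> verts D'\<close> show ?thesis by (simp add: is_source_def)
qed

section \<open>The cycle monomial lies outside the ordinary power\<close>

definition weight_exponent :: "'v wograph \<Rightarrow> 'v \<Rightarrow>\<^sub>0 nat" where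
  "weight_exponent D = (\<Sum>x\<in>verts D. Poly_Mapping.single x (weight D x))"

lemma lookup_weight_exponent:
  assumes "finite (verts D)"
  shows "Poly_Mapping.lookup (weight_exponent D) z = (if z \<in> verts D then weight D z else 0)"
  using assms by (simp add: weight_exponent_def lookup_sum lookup_single when_def)

text \<open>The head of an edge of \<open>D'\<close> is not a source there, so it keeps its weight
  from \<open>D\<close>; only the weight of the tail may drop to 1.\<close>

lemma induced_edge_weights:
  assumes "weighted_oriented_graph D" "induced_subgraph D' D" "(x, y) \<in> edges D'"
  shows "weight D' y = weight D y" "weight D' x \<ge> 1" "weight D' y \<ge> 1"
    "x \<in> verts D'" "y \<in> verts D'" "(x, y) \<in> edges D" "x \<noteq> y"
  using assms unfolding weighted_oriented_graph_def induced_subgraph_def is_source_def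
  by (auto split: if_splits)

text \<open>A factorization would give \<open>k\<close> edges on the cycle. They are pairwise
  disjoint, because an edge uses up the whole exponent of its head and a common tail of two edges is
  a source of \<open>D'\<close>, with exponent 1. So the cycle would need 2k vertices.\<close>

lemma weight_exponent_no_edge_sum:
  fixes D D' :: "'v wograph"
  assumes D: "weighted_oriented_graph D" and ind: "induced_subgraph D' D"
    and cyc: "underlying_cycle D' xs" and k: "length xs < 2 * k"
    and a: "a \<in> exponent_sums (edge_exponent D ` edges D) k"
  shows "weight_exponent D' \<noteq> a + c"
proof
  assume eq: "weight_exponent D' = a + c"
  have fin: "finite (verts D')" "card (verts D') = length xs"
    using cyc unfolding underlying_cycle_def by (auto simp: distinct_card)
  from a obtain g where g: "a = (\<Sum>i<k. g i)" "\<forall>i<k. g i \<in> edge_exponent D ` edges D"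
    unfolding exponent_sums_def by blast
  from g(2) have "\<forall>i\<in>{..<k}. \<exists>e. e \<in> edges D \<and> g i = edge_exponent D e" by blast
  then obtain h where h: "\<And>i. i < k \<Longrightarrow> h i \<in> edges D" "\<And>i. i < k \<Longrightarrow> g i = edge_exponent D (h i)"
    unfolding bchoice_iff by auto
  \<comment> \<open>Subsets \<open>S\<close> serve two purposes: singletons place each edge on the
    cycle, and pairs bound the joint exponent of two edges.\<close>
  have sum_le: "(\<Sum>i\<in>S. Poly_Mapping.lookup (edge_exponent D (h i)) z) \<le>
      (if z \<in> verts D' then weight D' z else 0)" if "S \<subseteq> {..<k}" for S z
  proof -
    have "(\<Sum>i\<in>S. Poly_Mapping.lookup (edge_exponent D (h i)) z) \<le>
        (\<Sum>i<k. Poly_Mapping.lookup (edge_exponent D (h i)) z)"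
      by (rule sum_mono2) (use that in auto)
    also have "\<dots> = Poly_Mapping.lookup a z"
      using h(2) by (simp add: g(1) lookup_sum)
    also have "\<dots> \<le> Poly_Mapping.lookup (weight_exponent D') z"
      by (simp add: eq lookup_add)
    finally show ?thesis by (simp add: lookup_weight_exponent fin)
  qed
  have wpos: "weight D y \<ge> 1" if "(x, y) \<in> edges D" for x y
    using D that unfolding weighted_oriented_graph_def by auto
  have edge': "h i \<in> edges D'" if i: "i < k" for i
  proof -
    obtain x y where xy: "h i = (x, y)" by (cases "h i")
    with h(1)[OF i] have xyD: "(x, y) \<in> edges D" by simp
    \<comment> \<open>Both exponents of an edge monomial are positive, whereas the cycle monomial
      has exponent 0 off the cycle.\<close>
    have "x \<in> verts D'" "y \<in> verts D'"
      using sum_le[of "{i}" x] sum_le[of "{i}" y] i wpos[OF xyD]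
      by (auto simp: xy lookup_edge_exponent split: if_splits)
    with xyD ind xy show ?thesis unfolding induced_subgraph_def by auto
  qed
  define T where "T i = {fst (h i), snd (h i)}" for i
  have card_T: "card (T i) = 2" "T i \<subseteq> verts D'" if "i < k" for i
    using induced_edge_weights[OF D ind, of "fst (h i)" "snd (h i)"] edge'[OF that]
    by (auto simp: T_def)
  have "T i \<inter> T j = {}" if ij: "i < k" "j < k" "i \<noteq> j" for i j
  proof -
    obtain x y where xy: "h i = (x, y)" by (cases "h i")
    obtain u v where uv: "h j = (u, v)" by (cases "h j")
    have e: "(x, y) \<in> edges D'" "(u, v) \<in> edges D'" using edge' ij xy uv by metis+
    note w1 = induced_edge_weights[OF D ind e(1)] and w2 = induced_edge_weights[OF D ind e(2)]
    have le: "((if z = x then 1 else 0) + (if z = y then weight D y else 0)) +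
        ((if z = u then 1 else 0) + (if z = v then weight D v else 0))
        \<le> (if z \<in> verts D' then weight D' z else 0)" for z
      using sum_le[of "{i, j}" z] ij by (simp add: xy uv lookup_edge_exponent)
    \<comment> \<open>The exponent available at \<open>y\<close> is \<open>weight D y\<close>, all
      of it taken by the first edge; a second edge through \<open>y\<close> adds at least 1.\<close>
    have 1: "y \<noteq> v" "y \<noteq> u" using le[of y] w1 w2 by auto
    have 2: "x \<noteq> v" using le[of v] w1 w2 by auto
    \<comment> \<open>A common tail has the distinct out-neighbours \<open>y\<close> and
      \<open>v\<close>, so it is a source of \<open>D'\<close>. The weight 1 convention in the
      induced subgraph then leaves exponent 1 where two edges need 2.\<close>
    have 3: "x \<noteq> u"
    proof
      assume "x = u"
      with e 1 have "is_source D' x" using two_out_neighbours_imp_source[OF D ind cyc] by blast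
      then have "weight D' x = 1" using ind w1(4) by (simp add: induced_subgraph_def)
      with le[of x] \<open>x = u\<close> w1 show False by auto
    qed
    from 1 2 3 show ?thesis by (auto simp: T_def xy uv)
  qed
  then have "card (\<Union>i<k. T i) = (\<Sum>i<k. card (T i))"
    by (intro card_UN_disjoint) (auto simp: T_def)
  also have "\<dots> = 2 * k" using card_T by simp
  finally have "2 * k \<le> card (verts D')"
    using card_mono[OF fin(1), of "\<Union>i<k. T i"] card_T(2) by force
  with fin(2) k show False by simp
qed

section \<open>Matchings on the cycle and the ordinary \<open>n\<close>-th power\<close>

lemma edge_exponent_divides_weights:
  assumes "weighted_oriented_graph D" "induced_subgraph D' D"
    and "(x, y) \<in> edges D' \<or> (y, x) \<in> edges D'"
  shows "\<exists>a \<in> edge_exponent D ` edges D. \<exists>c.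
    Poly_Mapping.single x (weight D' x) + Poly_Mapping.single y (weight D' y) = a + c"
proof -
  have *: "\<exists>a \<in> edge_exponent D ` edges D. \<exists>c.
    Poly_Mapping.single x (weight D' x) + Poly_Mapping.single y (weight D' y) = a + c"
    if e: "(x, y) \<in> edges D'" for x y
  proof -
    note w = induced_edge_weights[OF assms(1,2) e]
    \<comment> \<open>The head has the same weight in \<open>D'\<close> as in \<open>D\<close>, and
      the tail needs only exponent 1.\<close>
    have "\<exists>c. Poly_Mapping.single x (weight D' x) + Poly_Mapping.single y (weight D' y) =
        edge_exponent D (x, y) + c"
      by (rule exists_add_if_lookup_le)
        (use w in \<open>auto simp: lookup_edge_exponent lookup_add lookup_single when_def\<close>)
    with w(6) show ?thesis by blast
  qed
  from assms(3) show ?thesis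
    using *[of x y] *[of y x] by (auto simp: add.commute)
qed

lemma exponent_sums_divides:
  assumes "\<And>i. i < k \<Longrightarrow> \<exists>a \<in> A. \<exists>c. h i = a + c"
  shows "\<exists>a \<in> exponent_sums A k. \<exists>c. (\<Sum>i<k. h i) = a + c"
  using assms
proof (induction k)
  case (Suc k)
  then obtain a c b d where ab: "a \<in> exponent_sums A k" "(\<Sum>i<k. h i) = a + c" "b \<in> A" "h k = b + d"
    by (meson less_Suc_eq)
  then have "(\<Sum>i<Suc k. h i) = (a + b) + (c + d)" by (simp add: ac_simps)
  moreover have "a + b \<in> exponent_sums A (Suc k)" using ab unfolding exponent_sums_Suc by blast
  ultimately show ?case by blast
qed simp

text \<open>When the cycle is listed from \<open>v\<close> on, the other 2n vertices form a path,
  and pairing positions 1 and 2, 3 and 4, and so on gives \<open>n\<close> disjoint edges, each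
  contributing one edge monomial.\<close>

lemma path_matching_divides_weights:
  assumes D: "weighted_oriented_graph D" and ind: "induced_subgraph D' D"
    and cyc: "underlying_cycle D' xs" and len: "length xs = 2 * n + 1" and v: "v \<in> set xs"
  shows "\<exists>a \<in> exponent_sums (edge_exponent D ` edges D) n. \<exists>c.
    weight_exponent D' = Poly_Mapping.single v (weight D' v) + (a + c)"
proof -
  from v obtain j where j: "j < length xs" "v = xs ! j" by (metis in_set_conv_nth)
  define zs where "zs = rotate j xs"
  define h where "h i = Poly_Mapping.single (zs ! i) (weight D' (zs ! i))" for i
  have zs: "length zs = 2 * n + 1" "distinct zs" "set zs = verts D'"
    using cyc len by (auto simp: zs_def underlying_cycle_def)
  have zs0: "zs ! 0 = v" using j len nth_rotate[of 0 xs j] by (simp add: zs_def)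
  \<comment> \<open>The bound on \<open>i\<close> leaves out only the edge from the last vertex back
    to \<open>v\<close>, so the shifted index needs no reduction modulo the length.\<close>
  have adj: "(zs ! i, zs ! Suc i) \<in> edges D' \<or> (zs ! Suc i, zs ! i) \<in> edges D'" if "i < 2 * n" for i
  proof -
    let ?m = "(j + i) mod length xs"
    have "zs ! i = xs ! ?m" "zs ! Suc i = xs ! (Suc ?m mod length xs)"
      using that len by (simp_all add: zs_def nth_rotate mod_Suc_eq)
    moreover have "?m < length xs" using len by simp
    then have "{xs ! ?m, xs ! (Suc ?m mod length xs)} \<in> underlying_edges D'"
      using cyc unfolding underlying_cycle_def by blast
    ultimately show ?thesis by (auto simp: underlying_edges_def doubleton_eq_iff)
  qed
  have "weight_exponent D' = (\<Sum>i<2 * n + 1. h i)"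
    unfolding weight_exponent_def h_def zs(3)[symmetric] zs(1)[symmetric]
    by (rule sum.reindex_bij_betw[symmetric]) (use zs(2) in \<open>auto intro: bij_betw_nth\<close>)
  also have "\<dots> = h 0 + (\<Sum>i<2 * n. h (Suc i))"
    by (simp add: sum.lessThan_Suc_shift del: sum.lessThan_Suc)
  also have "(\<Sum>i<2 * n. h (Suc i)) = (\<Sum>i<n. h (Suc (2 * i)) + h (Suc (Suc (2 * i))))"
    by (induction n) (simp_all add: ac_simps)
  finally have eq: "weight_exponent D' =
    Poly_Mapping.single v (weight D' v) + (\<Sum>i<n. h (Suc (2 * i)) + h (Suc (Suc (2 * i))))"
    by (simp add: h_def zs0)
  have "\<exists>a \<in> exponent_sums (edge_exponent D ` edges D) n. \<exists>c.
      (\<Sum>i<n. h (Suc (2 * i)) + h (Suc (Suc (2 * i)))) = a + c"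
    unfolding h_def
    by (intro exponent_sums_divides edge_exponent_divides_weights[OF D ind] adj) simp
  with eq show ?thesis by metis
qed

section \<open>Comparison of the symbolic and the ordinary power\<close>

theorem proposition3p1:
  fixes D D' :: "'v wograph" and n :: nat and xs :: "'v list"
  assumes "weighted_oriented_graph D"
    and "induced_subgraph D' D"
    and "n \<ge> 1" and "length xs = 2 * n + 1" and "underlying_cycle D' xs"
    and "\<not> set xs \<subseteq> out_nbrs D (nontrivial_verts D)"
    and "(\<exists>v \<in> set xs - out_nbrs D (nontrivial_verts D). \<not> is_source D' v) \<or>
         (\<exists>v \<in> set xs - out_nbrs D (nontrivial_verts D). is_source D' v \<and> weight D v = 1)"
  shows "symbolic_power (poly_ring (verts D)) (edge_ideal D :: (('v \<Rightarrow>\<^sub>0 nat) \<Rightarrow>\<^sub>0 'k::field) set) (n + 1)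
       \<noteq> ideal_power (poly_ring (verts D)) (edge_ideal D) (n + 1)"
proof -
  note D = assms(1) and ind = assms(2) and len = assms(4) and cyc = assms(5)
  let ?R = "poly_ring (verts D) :: (('v \<Rightarrow>\<^sub>0 nat) \<Rightarrow>\<^sub>0 'k) ring"
  let ?E = "edge_exponent D ` edges D"
  let ?J = "monomial_ideal (verts D) (exponent_sums ?E (n + 1)) :: (('v \<Rightarrow>\<^sub>0 nat) \<Rightarrow>\<^sub>0 'k) set"
  let ?f = "monom_of (weight_exponent D') :: ('v \<Rightarrow>\<^sub>0 nat) \<Rightarrow>\<^sub>0 'k"
  have power: "ideal_power ?R (edge_ideal D) (n + 1) = ?J"
    unfolding edge_ideal_eq_monomial_ideal[OF D]
    by (rule ideal_power_monomial_ideal) (use keys_edge_exponent[OF D] in blast)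
  have verts': "verts D' = set xs" "verts D' \<subseteq> verts D"
    using cyc ind by (auto simp: underlying_cycle_def induced_subgraph_def)
  have weq: "weight D' x = (if is_source D' x then 1 else weight D x)" if "x \<in> set xs" for x
    using ind that verts' by (simp add: induced_subgraph_def)
  \<comment> \<open>Both alternatives of the condition yield equal weights: a vertex that is not a
    source of \<open>D'\<close> keeps its weight, and a source has weight 1 in \<open>D'\<close>
    and, by assumption, in \<open>D\<close>.\<close>
  from assms(7) obtain v where v: "v \<in> set xs" "v \<notin> out_nbrs D (nontrivial_verts D)"
    and wv: "weight D' v = weight D v"
    using weq by force
  have keys_f: "Poly_Mapping.keys (weight_exponent D') \<subseteq> verts D"
    using verts' by (auto simp: in_keys_iff lookup_weight_exponent split: if_splits)
  have "?f \<in> loc_contraction ?R P ?J" if P: "P \<in> Ass ?R (edge_ideal D)" for P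
  proof -
    interpret P: primeideal P ?R using P by (simp add: Ass_def)
    \<comment> \<open>As \<open>pvar y\<close> is outside the prime \<open>P\<close>, its power with
      exponent \<open>t\<close> becomes a unit, so this says that the power of \<open>x\<close> in
      the cycle monomial lies in the localized edge ideal.\<close>
    have "\<exists>x y t. x \<in> set xs \<and> y \<in> verts D \<and> pvar y \<notin> P \<and> (\<exists>a \<in> ?E. \<exists>c.
        Poly_Mapping.single y t + Poly_Mapping.single x (weight D' x) = a + c)"
    proof (cases "\<exists>y \<in> set xs. pvar y \<notin> P")
      case True
      then obtain i where i: "i < length xs" "pvar (xs ! i) \<notin> P" by (metis in_set_conv_nth)
      let ?x = "xs ! (Suc i mod length xs)"
      have "{xs ! i, ?x} \<in> underlying_edges D'"
        using cyc i(1) unfolding underlying_cycle_def by blast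
      then have "(xs ! i, ?x) \<in> edges D' \<or> (?x, xs ! i) \<in> edges D'"
        by (auto simp: underlying_edges_def doubleton_eq_iff)
      from edge_exponent_divides_weights[OF D ind this] i verts' len show ?thesis
        by (intro exI[of _ ?x] exI[of _ "xs ! i"] exI[of _ "weight D' (xs ! i)"]) auto
    next
      case False
      with v verts' obtain y where y: "y \<in> verts D" "pvar y \<notin> P" "(v, y) \<in> edges D \<or> (y, v) \<in> edges D"
        using associated_prime_misses_neighbour[OF D P, of v] by blast
      have wpos: "weight D x \<ge> 1" if "x \<in> verts D" for x
        using D that by (simp add: weighted_oriented_graph_def)
      \<comment> \<open>The vertex \<open>y\<close> may lie off the cycle, so its exponent is taken
        from \<open>D\<close>. An edge into \<open>v\<close> demands the full weight of
        \<open>v\<close> in \<open>D\<close>, which \<open>wv\<close> provides.\<close>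
      have "\<exists>a \<in> ?E. \<exists>c. Poly_Mapping.single y (weight D y) + Poly_Mapping.single v (weight D' v) = a + c"
        using y(3)
      proof
        assume e: "(v, y) \<in> edges D"
        have "\<exists>c. Poly_Mapping.single y (weight D y) + Poly_Mapping.single v (weight D' v) =
            edge_exponent D (v, y) + c"
          by (rule exists_add_if_lookup_le)
            (use wpos v verts' in \<open>auto simp: lookup_edge_exponent lookup_add lookup_single when_def wv\<close>)
        with e show ?thesis by blast
      next
        assume e: "(y, v) \<in> edges D"
        have "\<exists>c. Poly_Mapping.single y (weight D y) + Poly_Mapping.single v (weight D' v) =
            edge_exponent D (y, v) + c"
          by (rule exists_add_if_lookup_le)
            (use wpos y(1) in \<open>auto simp: lookup_edge_exponent lookup_add lookup_single when_def wv\<close>)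
        with e show ?thesis by blast
      qed
      with y v show ?thesis by blast
    qed
    then obtain x y t a c where x: "x \<in> set xs" and y: "y \<in> verts D" "pvar y \<notin> P" and a: "a \<in> ?E"
      and eq: "Poly_Mapping.single y t + Poly_Mapping.single x (weight D' x) = a + c" by blast
    from path_matching_divides_weights[OF D ind cyc len x] obtain b d
      where b: "b \<in> exponent_sums ?E n"
        "weight_exponent D' = Poly_Mapping.single x (weight D' x) + (b + d)" by blast
    \<comment> \<open>Regrouping collects the \<open>n\<close> matching edges in \<open>b\<close>
      and the extra edge \<open>a\<close> into \<open>n + 1\<close> edges, with \<open>c + d\<close>
      as cofactor.\<close>
    have "Poly_Mapping.single y t + weight_exponent D' =
        (Poly_Mapping.single y t + Poly_Mapping.single x (weight D' x)) + (b + d)"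
      by (simp add: b(2) ac_simps)
    also have "\<dots> = (b + a) + (c + d)" by (simp add: eq ac_simps)
    finally have "Poly_Mapping.single y t + weight_exponent D' = (b + a) + (c + d)" .
    moreover have "b + a \<in> exponent_sums ?E (n + 1)"
      using a b(1) by (auto simp: exponent_sums_Suc)
    moreover have "Poly_Mapping.keys (Poly_Mapping.single y t + weight_exponent D') \<subseteq> verts D"
      using keys_f y by (auto simp: keys_add_nat split: if_splits)
    ultimately have "monom_of (Poly_Mapping.single y t + weight_exponent D') \<in> ?J"
      unfolding monom_of_mem_monomial_ideal by blast
    then have sf: "monom_of (Poly_Mapping.single y t) \<otimes>\<^bsub>?R\<^esub> ?f \<in> ?J"
      by (simp add: mult_single)
    show ?thesis
    proof (rule mem_loc_contractionI[OF cring_poly_ring P.primeideal_axioms _ _ _ sf])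
      show "?J \<subseteq> carrier ?R" by (auto simp: monomial_ideal_def)
      show "?f \<in> carrier ?R" using keys_f by (simp add: poly_ring_carrier)
      show "monom_of (Poly_Mapping.single y t) \<in> carrier ?R - P"
        using monom_power_notin_prime[OF P.primeideal_axioms y] y by (simp add: poly_ring_carrier)
    qed
  qed
  then have "?f \<in> symbolic_power ?R (edge_ideal D) (n + 1)"
    using keys_f unfolding symbolic_power_def power by (simp add: poly_ring_carrier)
  \<comment> \<open>The cycle has 2n + 1 vertices, one fewer than \<open>n + 1\<close> disjoint
    edges would occupy.\<close>
  moreover have "?f \<notin> ?J"
    using weight_exponent_no_edge_sum[OF D ind cyc, of "n + 1"] len
    unfolding monom_of_mem_monomial_ideal by auto
  ultimately show ?thesis unfolding power by blast
qed

end
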